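(* The elements $\lbrace Z_n \rbrace_{n=1}^\infty$ of $\mathcal U^+_q$ are algebraically independent. Moreover the elements $\lbrace Z^\vee_n \rbrace_{n=1}^\infty$ of $\mathcal U^+_q$ are algebraically independent.
   Context: Let $\mathbb F$ be a field and fix a nonzero $q\in\mathbb F$ that is not a root of unity. $\mathbb N=\{0,1,2,\ldots\}$. All algebras are associative, over $\mathbb F$, with multiplicative identity. For elements $X,Y$ of an algebra, $[X,Y]=XY-YX$ and $[X,Y]_q=qXY-q^{-1}YX$. The algebra $\mathcal U^+_q$ is defined by generators (called alternating generators) $\mathcal W_{-k}, \mathcal W_{k+1}, \mathcal G_{k+1}, \mathcal{\tilde G}_{k+1}$ ($k\in\mathbb N$) and the following relations for all $k,\ell\in\mathbb N$: $[\mathcal W_0,\mathcal W_{k+1}]=[\mathcal W_{-k},\mathcal W_1]=(1-q^{-2})(\mathcal{\tilde G}_{k+1}-\mathcal G_{k+1})$; $[\mathcal W_0,\mathcal G_{k+1}]_q=[\mathcal{\tilde G}_{k+1},\mathcal W_0]_q=(q-q^{-1})\mathcal W_{-k-1}$; $[\mathcal G_{k+1},\mathcal W_1]_q=[\mathcal W_1,\mathcal{\tilde G}_{k+1}]_q=(q-q^{-1})\mathcal W_{k+2}$; $[\mathcal W_{-k},\mathcal W_{-\ell}]=0$; $[\mathcal W_{k+1},\mathcal W_{\ell+1}]=0$; $[\mathcal W_{-k},\mathcal W_{\ell+1}]+[\mathcal W_{k+1},\mathcal W_{-\ell}]=0$; $[\mathcal W_{-k},\mathcal G_{\ell+1}]+[\mathcal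 G_{k+1},\mathcal W_{-\ell}]=0$; $[\mathcal W_{-k},\mathcal{\tilde G}_{\ell+1}]+[\mathcal{\tilde G}_{k+1},\mathcal W_{-\ell}]=0$; $[\mathcal W_{k+1},\mathcal G_{\ell+1}]+[\mathcal G_{k+1},\mathcal W_{\ell+1}]=0$; $[\mathcal W_{k+1},\mathcal{\tilde G}_{\ell+1}]+[\mathcal{\tilde G}_{k+1},\mathcal W_{\ell+1}]=0$; $[\mathcal G_{k+1},\mathcal G_{\ell+1}]=0$; $[\mathcal{\tilde G}_{k+1},\mathcal{\tilde G}_{\ell+1}]=0$; $[\mathcal{\tilde G}_{k+1},\mathcal G_{\ell+1}]+[\mathcal G_{k+1},\mathcal{\tilde G}_{\ell+1}]=0$. Also $\mathcal G_0=\mathcal{\tilde G}_0=1$. In $\mathcal U^+_q$ define, for $n\ge1$, $Z^\vee_n=\sum_{k=0}^n\mathcal G_k\mathcal{\tilde G}_{n-k}q^{n-2k}-q\sum_{k=0}^{n-1}\mathcal W_{-k}\mathcal W_{n-k}q^{n-1-2k}$, and $Z^\vee_0=1$. Define recursively $Z_0=1$ and, for $n\ge 1$, $Z_n=\bigl(Z^\vee_n-\sum_{k=1}^{n-1}Z_kZ_{n-k}q^{n-2k}\bigr)/(q^n+q^{-n})$. (The elements $Z_n$, $Z_n^\vee$ are central in $\mathcal U^+_q$, so they mutually commute and algebraic independence over $\mathbb F$ makes sense.) *)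

theory Defs
  imports
    "HOL-Library.Poly_Mapping"
    "HOL-Algebra.QuotRing"
    "HOL-Algebra.Module"
    "HOL-Algebra.Algebraic_Closure_Type"
begin

section \<open>Algebras given by generators and relations\<close>

text \<open>The free monoid on a type of letters, written additively so that finitely supported
  functions on it form, with the convolution product, the free associative algebra.\<close>

datatype 'g free_monoid = Word (letters: "'g list")

instantiation free_monoid :: (type) monoid_add
begin

definition zero_free_monoid :: "'a free_monoid" where
  "0 = Word []"

definition plus_free_monoid :: "'a free_monoid \<Rightarrow> 'a free_monoid \<Rightarrow> 'a free_monoid" where
  "u + v = Word (letters u @ letters v)"

instance
  by standard (simp_all add: zero_free_monoid_def plus_free_monoid_def)

end

type_synonym ('g, 'a) free_algebra = "'g free_monoid \<Rightarrow>\<^sub>0 'a"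

definition Const :: "'a::field \<Rightarrow> ('g, 'a) free_algebra" where
  "Const c = Poly_Mapping.single 0 c"

definition Var :: "'g \<Rightarrow> ('g, 'a::field) free_algebra" where
  "Var g = Poly_Mapping.single (Word [g]) 1"

definition free_ring :: "('g, 'a::field) free_algebra ring" where
  "free_ring = ring_of_type_algebra"

text \<open>The algebra with the given relators: the quotient of the free algebra by the two-sided ideal
  they generate. Its elements are cosets; a scalar acts as multiplication by the coset of the
  corresponding constant.\<close>

definition presented_algebra ::
  "('g, 'a::field) free_algebra set \<Rightarrow> ('a, ('g, 'a) free_algebra set) module" where
  "presented_algebra S =
     (let I = Idl\<^bsub>free_ring\<^esub> S; Q = free_ring Quot I in
      ring.extend Q
        (module.fields (\<lambda>c u. (I +>\<^bsub>free_ring\<^esub> Const c) \<otimes>\<^bsub>Q\<^esub> u)))"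

definition presented_gen ::
  "('g, 'a::field) free_algebra set \<Rightarrow> 'g \<Rightarrow> ('g, 'a) free_algebra set" where
  "presented_gen S g = Idl\<^bsub>free_ring\<^esub> S +>\<^bsub>free_ring\<^esub> Var g"


section \<open>Algebraic independence\<close>

text \<open>Polynomials over \<open>'a\<close> in variables indexed by \<open>nat\<close> have type
  \<open>(nat \<Rightarrow>\<^sub>0 nat) \<Rightarrow>\<^sub>0 'a\<close>. The algebra need not be commutative; these notions are meant for
  families \<open>x\<close> that mutually commute, and then the (increasing) order of the factors in
  \<open>eval_monom\<close> is immaterial.\<close>

definition eval_monom ::
  "('a, 'b, 'm) module_scheme \<Rightarrow> (nat \<Rightarrow> 'b) \<Rightarrow> (nat \<Rightarrow>\<^sub>0 nat) \<Rightarrow> 'b" where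
  "eval_monom A x m =
     foldr (\<lambda>i y. (x i [^]\<^bsub>A\<^esub> Poly_Mapping.lookup m i) \<otimes>\<^bsub>A\<^esub> y)
       (sorted_list_of_set (Poly_Mapping.keys m)) \<one>\<^bsub>A\<^esub>"

definition eval_poly ::
  "('a::field, 'b, 'm) module_scheme \<Rightarrow> (nat \<Rightarrow> 'b) \<Rightarrow> ((nat \<Rightarrow>\<^sub>0 nat) \<Rightarrow>\<^sub>0 'a) \<Rightarrow> 'b" where
  "eval_poly A x p = (\<Oplus>\<^bsub>A\<^esub>m\<in>Poly_Mapping.keys p. Poly_Mapping.lookup p m \<odot>\<^bsub>A\<^esub> eval_monom A x m)"

definition algebraically_independent ::
  "('a::field, 'b, 'm) module_scheme \<Rightarrow> nat set \<Rightarrow> (nat \<Rightarrow> 'b) \<Rightarrow> bool" where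
  "algebraically_independent A J x \<longleftrightarrow>
     (\<forall>p. (\<forall>m\<in>Poly_Mapping.keys p. Poly_Mapping.keys m \<subseteq> J) \<longrightarrow> eval_poly A x p = \<zero>\<^bsub>A\<^esub> \<longrightarrow> p = 0)"


section \<open>The algebra \<open>U\<^sub>q\<^sup>+\<close> in its alternating presentation\<close>

text \<open>\<open>Gen_W i\<close> stands for \<open>W\<^sub>i\<close> with \<open>i\<close> any integer (so both \<open>W\<^sub>-\<^sub>k\<close> and \<open>W\<^sub>k\<^sub>+\<^sub>1\<close>, \<open>k \<in> \<nat>\<close>, are
  covered); \<open>Gen_G k\<close> and \<open>Gen_Gt k\<close> stand for \<open>G\<^sub>k\<^sub>+\<^sub>1\<close> and its tilde version.\<close>

datatype alt_gen = Gen_W int | Gen_G nat | Gen_Gt nat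

definition comm :: "'r::ring_1 \<Rightarrow> 'r \<Rightarrow> 'r" where
  "comm u v = u * v - v * u"

definition qcomm ::
  "'a::field \<Rightarrow> ('g, 'a) free_algebra \<Rightarrow> ('g, 'a) free_algebra \<Rightarrow> ('g, 'a) free_algebra" where
  "qcomm q u v = Const q * u * v - Const (inverse q) * v * u"

text \<open>Below, \<open>Wm k\<close>, \<open>Wp k\<close>, \<open>G k\<close>, \<open>Gt k\<close> are \<open>W\<^sub>-\<^sub>k\<close>, \<open>W\<^sub>k\<^sub>+\<^sub>1\<close>, \<open>G\<^sub>k\<^sub>+\<^sub>1\<close> and its tilde version.\<close>

definition alt_relators :: "'a::field \<Rightarrow> (alt_gen, 'a) free_algebra set" where
  "alt_relators q =
    (let Wm = (\<lambda>k::nat. Var (Gen_W (- int k)));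
         Wp = (\<lambda>k::nat. Var (Gen_W (int k + 1)));
         G  = (\<lambda>k::nat. Var (Gen_G k));
         Gt = (\<lambda>k::nat. Var (Gen_Gt k))
     in
      (\<Union>k. {comm (Wm 0) (Wp k) - Const (1 - inverse (q^2)) * (Gt k - G k),
            comm (Wm k) (Wp 0) - Const (1 - inverse (q^2)) * (Gt k - G k),
            qcomm q (Wm 0) (G k) - Const (q - inverse q) * Wm (k + 1),
            qcomm q (Gt k) (Wm 0) - Const (q - inverse q) * Wm (k + 1),
            qcomm q (G k) (Wp 0) - Const (q - inverse q) * Wp (k + 1),
            qcomm q (Wp 0) (Gt k) - Const (q - inverse q) * Wp (k + 1)})
      \<union> (\<Union>k l. {comm (Wm k) (Wm l),
            comm (Wp k) (Wp l),
            comm (Wm k) (Wp l) + comm (Wp k) (Wm l),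
            comm (Wm k) (G l) + comm (G k) (Wm l),
            comm (Wm k) (Gt l) + comm (Gt k) (Wm l),
            comm (Wp k) (G l) + comm (G k) (Wp l),
            comm (Wp k) (Gt l) + comm (Gt k) (Wp l),
            comm (G k) (G l),
            comm (Gt k) (Gt l),
            comm (Gt k) (G l) + comm (G k) (Gt l)}))"

type_synonym 'a alt_elem = "(alt_gen, 'a) free_algebra set"

definition Uqp :: "'a::field \<Rightarrow> ('a, 'a alt_elem) module" where
  "Uqp q = presented_algebra (alt_relators q)"

definition alt_W :: "'a::field \<Rightarrow> int \<Rightarrow> 'a alt_elem" where
  "alt_W q i = presented_gen (alt_relators q) (Gen_W i)"

fun alt_G :: "'a::field \<Rightarrow> nat \<Rightarrow> 'a alt_elem" where
  "alt_G q 0 = \<one>\<^bsub>Uqp q\<^esub>"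
| "alt_G q (Suc k) = presented_gen (alt_relators q) (Gen_G k)"

fun alt_Gt :: "'a::field \<Rightarrow> nat \<Rightarrow> 'a alt_elem" where
  "alt_Gt q 0 = \<one>\<^bsub>Uqp q\<^esub>"
| "alt_Gt q (Suc k) = presented_gen (alt_relators q) (Gen_Gt k)"


section \<open>The central elements\<close>

definition Zvee :: "'a::field \<Rightarrow> nat \<Rightarrow> 'a alt_elem" where
  "Zvee q n =
     (if n = 0 then \<one>\<^bsub>Uqp q\<^esub>
      else (\<Oplus>\<^bsub>Uqp q\<^esub>k\<in>{0..n}.
              q powi (int n - 2 * int k) \<odot>\<^bsub>Uqp q\<^esub> (alt_G q k \<otimes>\<^bsub>Uqp q\<^esub> alt_Gt q (n - k)))
           \<ominus>\<^bsub>Uqp q\<^esub>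
           q \<odot>\<^bsub>Uqp q\<^esub>
           (\<Oplus>\<^bsub>Uqp q\<^esub>k\<in>{0..<n}.
              q powi (int n - 1 - 2 * int k) \<odot>\<^bsub>Uqp q\<^esub>
                (alt_W q (- int k) \<otimes>\<^bsub>Uqp q\<^esub> alt_W q (int n - int k))))"

text \<open>Needed only for the termination of the recursion defining \<open>Zc\<close>.\<close>

lemma finsum_fundef_cong [fundef_cong]:
  assumes "A = B" and "\<And>x. x \<in> B \<Longrightarrow> f x = g x"
  shows "finsum R f A = finsum R g B"
proof -
  have *: "(C, y) \<in> foldSetD D (\<lambda>x. h (g' x)) e"
    if "(C, y) \<in> foldSetD D (\<lambda>x. h (f' x)) e" "\<And>x. x \<in> C \<Longrightarrow> f' x = g' x"
    for C D y e and h :: "'b \<Rightarrow> 'b \<Rightarrow> 'b" and f' g' :: "'a \<Rightarrow> 'b"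
    using that
  proof induction
    case emptyI
    then show ?case by (simp add: foldSetD.emptyI)
  next
    case (insertI x C y)
    then have "f' x = g' x" and "(C, y) \<in> foldSetD D (\<lambda>x. h (g' x)) e"
      by auto
    then show ?case
      using insertI.hyps foldSetD.insertI [of x C "\<lambda>x. h (g' x)" y D e] by simp
  qed
  have "(A, y) \<in> foldSetD D (\<lambda>x. h (f x)) e \<longleftrightarrow> (A, y) \<in> foldSetD D (\<lambda>x. h (g x)) e"
    for D y e and h :: "'b \<Rightarrow> 'b \<Rightarrow> 'b"
    using *[of A y D h f e g] *[of A y D h g e f] assms by auto
  then show ?thesis
    unfolding finsum_def finprod_def foldD_def comp_def using assms(1) by simp
qed

function Zc :: "'a::field \<Rightarrow> nat \<Rightarrow> 'a alt_elem" where
  "Zc q n =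
     (if n = 0 then \<one>\<^bsub>Uqp q\<^esub>
      else inverse (q powi int n + q powi (- int n)) \<odot>\<^bsub>Uqp q\<^esub>
           (Zvee q n \<ominus>\<^bsub>Uqp q\<^esub>
            (\<Oplus>\<^bsub>Uqp q\<^esub>k\<in>{1..<n}.
               q powi (int n - 2 * int k) \<odot>\<^bsub>Uqp q\<^esub> (Zc q k \<otimes>\<^bsub>Uqp q\<^esub> Zc q (n - k)))))"
  by pat_completeness auto
termination
  by (relation "measure snd") auto

declare Zc.simps [simp del]

end

theory Submission
  imports Defs
begin

text \<open>Elements are algebraically independent if their images under some homomorphism are, and
  \<open>U\<^sub>q\<^sup>+\<close> has a large commutative quotient. Kill all \<open>W\<^sub>i\<close> and identify
  each \<open>G\<^sub>k\<close> with its tilde version: every defining relation becomes trivial, because each of its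
  terms is a commutator, contains some \<open>W\<^sub>i\<close>, or is a difference of the two elements that are
  identified. Hence for every sequence \<open>g\<close> of commutative polynomials with \<open>g\<^sub>0 = 1\<close> there is a
  homomorphism \<open>alt_eval g\<close> from \<open>U\<^sub>q\<^sup>+\<close> to the polynomial ring in \<open>x\<^sub>0, x\<^sub>1, \<dots>\<close> that
  sends the \<open>W\<^sub>i\<close> to \<open>0\<close> and both \<open>G\<^sub>k\<close> and its tilde version to \<open>g\<^sub>k\<close>.

  Under \<open>alt_eval g\<close> the \<open>n\<close>-th of the elements \<open>Zvee\<close> becomes
  \<open>\<Sum>\<^sub>k q\<^bsup>n-2k\<^esup> g\<^sub>k g\<^sub>n\<^sub>-\<^sub>k\<close> (lemma \<open>alt_eval_Zvee\<close>), which is precisely the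
  expression that the recursion for \<open>Zc\<close> inverts. So \<open>Zc q n\<close> goes to \<open>g\<^sub>n\<close> (lemma
  \<open>alt_eval_Zc\<close>). Taking \<open>g\<^sub>n = x\<^sub>n\<close> for \<open>n \<ge> 1\<close> sends the elements \<open>Zc q n\<close>
  to distinct variables, which gives the first half.

  For the second half, the freedom in \<open>g\<close> replaces an argument with triangular
  systems: solve \<open>\<Sum>\<^sub>k q\<^bsup>n-2k\<^esup> g\<^sub>k g\<^sub>n\<^sub>-\<^sub>k = x\<^sub>n\<close> recursively for \<open>g\<^sub>n\<close>. The two end terms contribute
  \<open>(q\<^sup>n + q\<^bsup>-n\<^esup>) g\<^sub>n\<close>, whose coefficient is nonzero because \<open>q\<close> is not a root of unity. For this
  \<open>g\<close> the elements \<open>Zvee q n\<close> themselves go to distinct variables.\<close>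

section \<open>Type-class rings as ring structures\<close>

lemma ring_of_type_algebra_simps [simp]:
  "carrier ring_of_type_algebra = UNIV"
  "a \<otimes>\<^bsub>ring_of_type_algebra\<^esub> b = a * b"
  "\<one>\<^bsub>ring_of_type_algebra\<^esub> = 1"
  "\<zero>\<^bsub>ring_of_type_algebra\<^esub> = 0"
  "a \<oplus>\<^bsub>ring_of_type_algebra\<^esub> b = a + b"
  by (simp_all add: ring_of_type_algebra_def)

text \<open>The structure on a type is considered for rings that need not be commutative, since the free
  algebra is one of them.\<close>

lemma ring_ring_of_type_algebra: "ring (ring_of_type_algebra :: 'r::ring_1 ring)"
proof -
  have "\<exists>y. x + y = 0" for x :: 'r
    using add.right_inverse by blast
  then show ?thesis
    unfolding ring_of_type_algebra_def using add.right_inverse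
    by unfold_locales (auto simp: algebra_simps Units_def)
qed

lemma a_minus_ring_of_type_algebra [simp]:
  fixes a b :: "'r::ring_1"
  shows "a \<ominus>\<^bsub>ring_of_type_algebra\<^esub> b = a - b"
proof -
  interpret ring "ring_of_type_algebra :: 'r ring"
    by (rule ring_ring_of_type_algebra)
  have "\<ominus>\<^bsub>ring_of_type_algebra\<^esub> b = - b"
    using r_neg[of b] by (simp add: eq_neg_iff_add_eq_0 add.commute)
  then show ?thesis
    by (simp add: a_minus_def)
qed

lemma finsum_ring_of_type_algebra [simp]:
  fixes f :: "'i \<Rightarrow> 'r::ring_1"
  assumes "finite A"
  shows "finsum ring_of_type_algebra f A = sum f A"
proof -
  interpret ring "ring_of_type_algebra :: 'r ring"
    by (rule ring_ring_of_type_algebra)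
  show ?thesis
    using assms by (induction A rule: finite_induct) auto
qed

section \<open>Evaluation of noncommutative polynomials\<close>

lemma poly_mapping_single_add_induct [case_names zero single add]:
  fixes p :: "'k \<Rightarrow>\<^sub>0 'c::monoid_add"
  assumes zero: "P 0"
    and single: "\<And>k c. P (Poly_Mapping.single k c)"
    and add: "\<And>p p'. P p \<Longrightarrow> P p' \<Longrightarrow> P (p + p')"
  shows "P p"
proof (induction p rule: update_induct)
  case const
  show ?case by (rule zero)
next
  case (update p k c)
  have "Poly_Mapping.update k c p = Poly_Mapping.single k c + p"
    using update(1)
    by (intro poly_mapping_eqI)
      (auto simp: lookup_update lookup_add lookup_single when_def in_keys_iff)
  with update show ?case
    by (simp add: add single)
qed

text \<open>The algebra homomorphism from the free algebra that sends each letter \<open>g\<close> to \<open>\<phi> g\<close>. The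
  target is a commutative monoid algebra, so scalars act through coefficients of the monomial
  \<open>0\<close>, and the image of a scalar commutes with everything.\<close>

definition free_eval ::
  "('g \<Rightarrow> 'm::comm_monoid_add \<Rightarrow>\<^sub>0 'a) \<Rightarrow> ('g, 'a::field) free_algebra \<Rightarrow> 'm \<Rightarrow>\<^sub>0 'a" where
  "free_eval \<phi> p =
     (\<Sum>w\<in>Poly_Mapping.keys p.
        Poly_Mapping.single 0 (Poly_Mapping.lookup p w) * prod_list (map \<phi> (letters w)))"

lemma free_eval_zero [simp]: "free_eval \<phi> 0 = 0"
  by (simp add: free_eval_def)

lemma free_eval_single:
  "free_eval \<phi> (Poly_Mapping.single w c) = Poly_Mapping.single 0 c * prod_list (map \<phi> (letters w))"
  by (cases "c = 0") (simp_all add: free_eval_def)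

lemma free_eval_add [simp]: "free_eval \<phi> (p + p') = free_eval \<phi> p + free_eval \<phi> p'"
  unfolding free_eval_def
  by (rule setsum_keys_plus_distrib) (simp_all add: single_add algebra_simps)

lemma free_eval_diff [simp]: "free_eval \<phi> (p - p') = free_eval \<phi> p - free_eval \<phi> p'"
  using free_eval_add[of \<phi> "p - p'" p'] by (simp add: algebra_simps)

lemma free_eval_mult [simp]:
  fixes \<phi> :: "'g \<Rightarrow> 'm::comm_monoid_add \<Rightarrow>\<^sub>0 'a::field"
  shows "free_eval \<phi> (p * p') = free_eval \<phi> p * free_eval \<phi> p'"
proof (induction p rule: poly_mapping_single_add_induct)
  case (single u c)
  show ?case
  proof (induction p' rule: poly_mapping_single_add_induct)
    case (single v d)
    have "free_eval \<phi> (Poly_Mapping.single u c * Poly_Mapping.single v d) =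
        Poly_Mapping.single 0 (c * d) *
          (prod_list (map \<phi> (letters u)) * prod_list (map \<phi> (letters v)))"
      by (simp add: mult_single free_eval_single plus_free_monoid_def)
    also have "Poly_Mapping.single (0::'m) (c * d) =
        Poly_Mapping.single 0 c * Poly_Mapping.single 0 d"
      by (simp add: mult_single)
    finally show ?case
      by (simp add: free_eval_single mult_ac)
  qed (simp_all add: algebra_simps)
qed (simp_all add: algebra_simps)

lemma free_eval_Const [simp]: "free_eval \<phi> (Const c) = Poly_Mapping.single 0 c"
  by (simp add: Const_def free_eval_single zero_free_monoid_def)

lemma free_eval_Var [simp]: "free_eval \<phi> (Var g) = \<phi> g"
  by (simp add: Var_def free_eval_single)

lemma free_eval_one [simp]: "free_eval \<phi> 1 = 1"
  using free_eval_Const[of \<phi> 1] by (simp add: Const_def)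

section \<open>Homomorphisms out of a presented algebra\<close>

lemma ring_free_ring: "ring (free_ring :: ('g, 'a::field) free_algebra ring)"
  unfolding free_ring_def by (rule ring_ring_of_type_algebra)

lemma free_ring_simps [simp]:
  "carrier free_ring = UNIV"
  "p \<otimes>\<^bsub>free_ring\<^esub> p' = p * p'"
  "\<one>\<^bsub>free_ring\<^esub> = 1"
  "p \<oplus>\<^bsub>free_ring\<^esub> p' = p + p'"
  by (simp_all add: free_ring_def)

lemma ideal_relators: "ideal (Idl\<^bsub>free_ring\<^esub> S) (free_ring :: ('g, 'a::field) free_algebra ring)"
  by (rule ring.genideal_ideal[OF ring_free_ring]) simp

text \<open>The record with scalar multiplication has the same ring operations as the quotient ring, but a
  different type, so the axioms are transferred one by one.\<close>

lemma ring_presented_algebra: "ring (presented_algebra S)"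
proof -
  let ?Q = "free_ring Quot (Idl\<^bsub>free_ring\<^esub> S)"
  interpret Q: ring ?Q
    by (rule ideal.quotient_is_ring[OF ideal_relators])
  have eq: "carrier (presented_algebra S) = carrier ?Q"
    "monoid.mult (presented_algebra S) = monoid.mult ?Q"
    "\<one>\<^bsub>presented_algebra S\<^esub> = \<one>\<^bsub>?Q\<^esub>"
    "\<zero>\<^bsub>presented_algebra S\<^esub> = \<zero>\<^bsub>?Q\<^esub>"
    "add (presented_algebra S) = add ?Q"
    by (simp_all add: presented_algebra_def Let_def ring.extend_def module.fields_def)
  have neg: "\<exists>v\<in>carrier ?Q. v \<oplus>\<^bsub>?Q\<^esub> u = \<zero>\<^bsub>?Q\<^esub>" if "u \<in> carrier ?Q" for u
    using Q.l_neg[OF that] Q.a_inv_closed[OF that] by blast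
  show ?thesis
    by (intro ringI abelian_groupI monoidI; unfold eq)
      (simp_all add: Q.m_assoc Q.l_distr Q.r_distr Q.a_ac neg)
qed

lemma coset_hom_presented_algebra:
  "(+>\<^bsub>free_ring\<^esub>) (Idl\<^bsub>free_ring\<^esub> S) \<in> ring_hom free_ring (presented_algebra S)"
  using ideal.rcos_ring_hom[OF ideal_relators[of S]]
  by (simp add: presented_algebra_def Let_def ring.extend_def module.fields_def ring_hom_def)

lemma carrier_presented_algebra:
  "carrier (presented_algebra S) = range ((+>\<^bsub>free_ring\<^esub>) (Idl\<^bsub>free_ring\<^esub> S))"
  by (auto simp: presented_algebra_def Let_def ring.extend_def module.fields_def FactRing_def
      A_RCOSETS_def')

lemma presented_gen_closed: "presented_gen S g \<in> carrier (presented_algebra S)"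
  by (simp add: carrier_presented_algebra presented_gen_def)

lemma smult_presented_algebra:
  "c \<odot>\<^bsub>presented_algebra S\<^esub> u =
     (Idl\<^bsub>free_ring\<^esub> S +>\<^bsub>free_ring\<^esub> Const c) \<otimes>\<^bsub>presented_algebra S\<^esub> u"
  by (simp add: presented_algebra_def Let_def ring.extend_def module.fields_def)

lemma smult_presented_algebra_closed:
  assumes "u \<in> carrier (presented_algebra S)"
  shows "c \<odot>\<^bsub>presented_algebra S\<^esub> u \<in> carrier (presented_algebra S)"
proof -
  interpret ring "presented_algebra S" by (rule ring_presented_algebra)
  show ?thesis
    unfolding smult_presented_algebra using assms
    by (intro m_closed) (simp_all add: carrier_presented_algebra)
qed

text \<open>The map that \<open>free_eval\<close> induces on cosets. The choice of a representative is immaterial as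
  soon as the relators evaluate to \<open>0\<close>, see \<open>presented_eval_coset\<close> below.\<close>

definition presented_eval ::
  "('g \<Rightarrow> 'm::comm_monoid_add \<Rightarrow>\<^sub>0 'a) \<Rightarrow> ('g, 'a::field) free_algebra set \<Rightarrow> 'm \<Rightarrow>\<^sub>0 'a" where
  "presented_eval \<phi> K = free_eval \<phi> (SOME p. p \<in> K)"

text \<open>The kernel of \<open>free_eval \<phi>\<close> is an ideal containing the relators, and the ideal they generate
  is the smallest such.\<close>

lemma free_eval_relators_ideal:
  assumes "\<And>s. s \<in> S \<Longrightarrow> free_eval \<phi> s = 0" and "p \<in> Idl\<^bsub>free_ring\<^esub> S"
  shows "free_eval \<phi> p = 0"
proof -
  have "free_eval \<phi> \<in> ring_hom free_ring ring_of_type_algebra"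
    by (rule ring_hom_memI) simp_all
  then have "ring_hom_ring free_ring ring_of_type_algebra (free_eval \<phi>)"
    by (rule ring_hom_ringI2[OF ring_free_ring ring_ring_of_type_algebra])
  then have "ideal (a_kernel free_ring ring_of_type_algebra (free_eval \<phi>)) free_ring"
    by (rule ring_hom_ring.kernel_is_ideal)
  moreover have "S \<subseteq> a_kernel free_ring ring_of_type_algebra (free_eval \<phi>)"
    using assms(1) by (auto simp: a_kernel_def')
  ultimately have "Idl\<^bsub>free_ring\<^esub> S \<subseteq> a_kernel free_ring ring_of_type_algebra (free_eval \<phi>)"
    by (rule ring.genideal_minimal[OF ring_free_ring])
  with assms(2) show ?thesis
    by (auto simp: a_kernel_def')
qed

lemma presented_eval_coset:
  assumes "\<And>s. s \<in> S \<Longrightarrow> free_eval \<phi> s = 0"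
  shows "presented_eval \<phi> (Idl\<^bsub>free_ring\<^esub> S +>\<^bsub>free_ring\<^esub> p) = free_eval \<phi> p"
proof -
  let ?K = "Idl\<^bsub>free_ring\<^esub> S +>\<^bsub>free_ring\<^esub> p"
  interpret ideal "Idl\<^bsub>free_ring\<^esub> S" free_ring
    by (rule ideal_relators)
  have "p \<in> ?K"
    by (rule a_rcos_self) simp
  then have "(SOME p. p \<in> ?K) \<in> ?K"
    by (rule someI)
  then obtain i where "i \<in> Idl\<^bsub>free_ring\<^esub> S" "(SOME p. p \<in> ?K) = i + p"
    by (auto simp: a_r_coset_def')
  then show ?thesis
    using free_eval_relators_ideal[OF assms] by (simp add: presented_eval_def)
qed

text \<open>The universal property of a presentation: since the cosets are the image of a homomorphism
  from the free algebra, compatibility with the operations is inherited from \<open>free_eval\<close>.\<close>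

lemma presented_eval_hom:
  assumes "\<And>s. s \<in> S \<Longrightarrow> free_eval \<phi> s = 0"
  shows "presented_eval \<phi> \<in> ring_hom (presented_algebra S) ring_of_type_algebra"
proof -
  note coset = presented_eval_coset[of S \<phi>, OF assms]
  note hom = coset_hom_presented_algebra[of S]
  show ?thesis
    using ring_hom_mult[OF hom, symmetric] ring_hom_add[OF hom, symmetric]
      ring_hom_one[OF hom, symmetric]
    by (intro ring_hom_memI) (auto simp: carrier_presented_algebra coset)
qed

lemma presented_eval_smult:
  assumes "\<And>s. s \<in> S \<Longrightarrow> free_eval \<phi> s = 0" and "u \<in> carrier (presented_algebra S)"
  shows "presented_eval \<phi> (c \<odot>\<^bsub>presented_algebra S\<^esub> u) =
    Poly_Mapping.single 0 c * presented_eval \<phi> u"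
proof -
  note coset = presented_eval_coset[of S \<phi>, OF assms(1)]
  have "Idl\<^bsub>free_ring\<^esub> S +>\<^bsub>free_ring\<^esub> Const c \<in> carrier (presented_algebra S)"
    by (simp add: carrier_presented_algebra)
  then show ?thesis
    using ring_hom_mult[OF presented_eval_hom[of S \<phi>, OF assms(1)] _ assms(2)]
    by (simp add: smult_presented_algebra coset)
qed

section \<open>Algebraic independence from a homomorphism\<close>

definition indet :: "nat \<Rightarrow> (nat \<Rightarrow>\<^sub>0 nat) \<Rightarrow>\<^sub>0 'a::field" where
  "indet i = Poly_Mapping.single (Poly_Mapping.single i 1) 1"

lemma indet_power: "indet i ^ n = Poly_Mapping.single (Poly_Mapping.single i n) 1"
  by (induction n) (simp_all add: indet_def mult_single flip: single_add)

text \<open>If the elements go to distinct indeterminates under an algebra homomorphism \<open>H\<close>, then \<open>H\<close>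
  maps the value of a polynomial \<open>p\<close> at them back to \<open>p\<close> itself, so a vanishing value
  forces \<open>p = 0\<close>.\<close>

lemma algebraically_independent_if_hom_to_indets:
  fixes A :: "('a::field, 'b, 'm) module_scheme"
  assumes ring: "ring A"
    and hom: "H \<in> ring_hom A ring_of_type_algebra"
    and smult_closed: "\<And>c u. u \<in> carrier A \<Longrightarrow> c \<odot>\<^bsub>A\<^esub> u \<in> carrier A"
    and smult: "\<And>c u. u \<in> carrier A \<Longrightarrow> H (c \<odot>\<^bsub>A\<^esub> u) = Poly_Mapping.single 0 c * H u"
    and closed: "\<And>i. i \<in> J \<Longrightarrow> x i \<in> carrier A"
    and indet: "\<And>i. i \<in> J \<Longrightarrow> H (x i) = indet i"
  shows "algebraically_independent A J x"
proof -
  interpret H: ring_hom_ring A ring_of_type_algebra H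
    by (intro ring_hom_ringI2 ring ring_ring_of_type_algebra hom)
  have pow: "H (u [^]\<^bsub>A\<^esub> n) = H u ^ n" if "u \<in> carrier A" for u and n :: nat
    using that by (induction n) simp_all
  have foldr: "foldr (\<lambda>i y. (x i [^]\<^bsub>A\<^esub> k i) \<otimes>\<^bsub>A\<^esub> y) is \<one>\<^bsub>A\<^esub> \<in> carrier A \<and>
      H (foldr (\<lambda>i y. (x i [^]\<^bsub>A\<^esub> k i) \<otimes>\<^bsub>A\<^esub> y) is \<one>\<^bsub>A\<^esub>) =
        Poly_Mapping.single (sum_list (map (\<lambda>i. Poly_Mapping.single i (k i)) is)) 1"
    if "set is \<subseteq> J" for k :: "nat \<Rightarrow> nat" and "is"
    using that by (induction "is") (auto simp: closed pow indet indet_power mult_single)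
  have monom: "eval_monom A x m \<in> carrier A \<and> H (eval_monom A x m) = Poly_Mapping.single m 1"
    if m: "Poly_Mapping.keys m \<subseteq> J" for m
  proof -
    have "sum_list (map (\<lambda>i. Poly_Mapping.single i (Poly_Mapping.lookup m i))
        (sorted_list_of_set (Poly_Mapping.keys m))) = m"
      by (intro poly_mapping_eqI)
        (simp add: sum_list_distinct_conv_sum_set lookup_sum lookup_single when_def in_keys_iff)
    then show ?thesis
      using foldr[of "sorted_list_of_set (Poly_Mapping.keys m)" "Poly_Mapping.lookup m"] m
      by (simp add: eval_monom_def)
  qed
  show ?thesis
    unfolding algebraically_independent_def
  proof (intro allI impI)
    fix p :: "(nat \<Rightarrow>\<^sub>0 nat) \<Rightarrow>\<^sub>0 'a"
    assume J: "\<forall>m\<in>Poly_Mapping.keys p. Poly_Mapping.keys m \<subseteq> J" and "eval_poly A x p = \<zero>\<^bsub>A\<^esub>"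
    then have "0 = H (eval_poly A x p)"
      by simp
    also have "\<dots> = (\<Sum>m\<in>Poly_Mapping.keys p. H (Poly_Mapping.lookup p m \<odot>\<^bsub>A\<^esub> eval_monom A x m))"
      unfolding eval_poly_def using J monom
      by (subst H.hom_finsum) (auto intro!: smult_closed)
    also have "\<dots> = (\<Sum>m\<in>Poly_Mapping.keys p. Poly_Mapping.single m (Poly_Mapping.lookup p m))"
      using J monom by (intro sum.cong) (simp_all add: smult mult_single)
    also have "\<dots> = p"
      by (intro poly_mapping_eqI)
        (simp add: lookup_sum lookup_single when_def in_keys_iff)
    finally show "p = 0" by simp
  qed
qed

section \<open>A commutative quotient of \<open>U\<^sub>q\<^sup>+\<close>\<close>

text \<open>The generators on which \<open>alt_eval g\<close> is prescribed. \<open>Gen_G k\<close> stands for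
  \<open>G\<^sub>k\<^sub>+\<^sub>1\<close>, hence the shift; with \<open>g 0 = 1\<close> the convention \<open>G\<^sub>0 = 1\<close> is respected as well.\<close>

fun alt_subst :: "(nat \<Rightarrow> 'b::zero) \<Rightarrow> alt_gen \<Rightarrow> 'b" where
  "alt_subst g (Gen_W i) = 0"
| "alt_subst g (Gen_G k) = g (Suc k)"
| "alt_subst g (Gen_Gt k) = g (Suc k)"

text \<open>All commutators vanish in a commutative target; the \<open>q\<close>-commutators always involve some \<open>W\<^sub>i\<close>, on
  both sides of their relation; and the difference of \<open>G\<^sub>k\<^sub>+\<^sub>1\<close> and its tilde version is sent to \<open>0\<close>.\<close>

lemma free_eval_alt_relators:
  assumes "s \<in> alt_relators q"
  shows "free_eval (alt_subst g) s = 0"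
  using assms by (auto simp: alt_relators_def Let_def comm_def qcomm_def)

lemma alt_W_closed: "alt_W q i \<in> carrier (Uqp q)"
  by (simp add: alt_W_def Uqp_def presented_gen_closed)

lemma ring_Uqp: "ring (Uqp q)"
  by (simp add: Uqp_def ring_presented_algebra)

lemma alt_G_closed: "alt_G q k \<in> carrier (Uqp q)" and alt_Gt_closed: "alt_Gt q k \<in> carrier (Uqp q)"
  using ring.ring_simprules(6)[OF ring_Uqp[of q]]
  by (cases k; simp add: Uqp_def presented_gen_closed)+

lemma smult_Uqp_closed: "u \<in> carrier (Uqp q) \<Longrightarrow> c \<odot>\<^bsub>Uqp q\<^esub> u \<in> carrier (Uqp q)"
  by (simp add: Uqp_def smult_presented_algebra_closed)

lemma Zvee_closed: "Zvee q n \<in> carrier (Uqp q)"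
proof -
  interpret ring "Uqp q" by (rule ring_Uqp)
  show ?thesis
    unfolding Zvee_def
    by (auto intro!: smult_Uqp_closed minus_closed finsum_closed m_closed
        alt_W_closed alt_G_closed alt_Gt_closed)
qed

lemma Zc_closed: "Zc q n \<in> carrier (Uqp q)"
proof (induction n rule: less_induct)
  case (less n)
  interpret ring "Uqp q" by (rule ring_Uqp)
  show ?case
    by (subst Zc.simps)
      (auto intro!: smult_Uqp_closed minus_closed finsum_closed m_closed Zvee_closed less)
qed

abbreviation alt_eval ::
  "(nat \<Rightarrow> (nat \<Rightarrow>\<^sub>0 nat) \<Rightarrow>\<^sub>0 'a::field) \<Rightarrow> 'a alt_elem \<Rightarrow> (nat \<Rightarrow>\<^sub>0 nat) \<Rightarrow>\<^sub>0 'a" where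
  "alt_eval g \<equiv> presented_eval (alt_subst g)"

lemma alt_eval_hom: "alt_eval g \<in> ring_hom (Uqp q) ring_of_type_algebra"
  unfolding Uqp_def by (intro presented_eval_hom free_eval_alt_relators)

lemma alt_eval_smult:
  "u \<in> carrier (Uqp q) \<Longrightarrow> alt_eval g (c \<odot>\<^bsub>Uqp q\<^esub> u) = Poly_Mapping.single 0 c * alt_eval g u"
  unfolding Uqp_def by (intro presented_eval_smult free_eval_alt_relators)

lemma alt_eval_ring_hom_ring: "ring_hom_ring (Uqp q) ring_of_type_algebra (alt_eval g)"
  by (intro ring_hom_ringI2 ring_Uqp ring_ring_of_type_algebra alt_eval_hom)

lemma alt_eval_gen: "alt_eval g (presented_gen (alt_relators q) x) = alt_subst g x"
  unfolding presented_gen_def by (simp add: presented_eval_coset[OF free_eval_alt_relators])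

lemma alt_eval_W: "alt_eval g (alt_W q i) = 0"
  by (simp add: alt_W_def alt_eval_gen)

lemma alt_eval_G:
  assumes "g 0 = 1"
  shows "alt_eval g (alt_G q k) = g k" "alt_eval g (alt_Gt q k) = g k"
  using assms ring_hom_one[OF alt_eval_hom[of g q]]
  by (cases k; simp add: alt_eval_gen)+

lemma ring_hom_ring_minus:
  assumes "ring_hom_ring A ring_of_type_algebra H" "u \<in> carrier A" "v \<in> carrier A"
  shows "H (u \<ominus>\<^bsub>A\<^esub> v) = H u - H v"
proof -
  interpret H: ring_hom_ring A ring_of_type_algebra H by fact
  show ?thesis
    using assms(2,3) a_minus_ring_of_type_algebra[of "H u" "H v"] by (simp add: a_minus_def)
qed

text \<open>The second sum in the definition of \<open>Zvee\<close> disappears because its factors \<open>W\<^sub>i\<close> do. For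
  \<open>n = 0\<close> the convolution reduces to \<open>g\<^sub>0 g\<^sub>0 = 1\<close>.\<close>

lemma alt_eval_Zvee:
  assumes "g 0 = 1"
  shows "alt_eval g (Zvee q n) =
    (\<Sum>k=0..n. Poly_Mapping.single 0 (q powi (int n - 2 * int k)) * (g k * g (n - k)))"
proof (cases "n = 0")
  case True
  then show ?thesis
    using assms ring_hom_one[OF alt_eval_hom[of g q]] by (simp add: Zvee_def)
next
  case False
  interpret H: ring_hom_ring "Uqp q" ring_of_type_algebra "alt_eval g"
    by (rule alt_eval_ring_hom_ring)
  note closed = smult_Uqp_closed alt_W_closed alt_G_closed alt_Gt_closed
  show ?thesis
    using False
    by (simp add: Zvee_def ring_hom_ring_minus[OF alt_eval_ring_hom_ring] closed
        alt_eval_smult alt_eval_W alt_eval_G[of g, OF assms] Pi_def)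
qed

definition qpow_sum :: "'a::field \<Rightarrow> nat \<Rightarrow> 'a" where
  "qpow_sum q n = q powi int n + q powi (- int n)"

lemma qpow_sum_nonzero:
  fixes q :: "'a::field"
  assumes "q \<noteq> 0" and "\<forall>n::nat. n \<ge> 1 \<longrightarrow> q ^ n \<noteq> 1" and "n \<ge> 1"
  shows "qpow_sum q n \<noteq> 0"
proof
  assume "qpow_sum q n = 0"
  \<comment> \<open>Squaring this contradicts that \<open>q\<close> is not a root of unity.\<close>
  then have "q ^ n * q ^ n = - 1"
    using assms(1) by (simp add: qpow_sum_def power_int_minus field_simps eq_neg_iff_add_eq_0)
  moreover have "q ^ (4 * n) = (q ^ n * q ^ n) * (q ^ n * q ^ n)"
  proof -
    have "4 * n = (n + n) + (n + n)"
      by simp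
    then show ?thesis
      by (simp only: power_add)
  qed
  ultimately have "q ^ (4 * n) = 1"
    by simp
  with assms(2,3) show False by simp
qed

text \<open>The first and last terms of the convolution are the only ones that contain \<open>g n\<close>; isolating
  them allows one to solve for \<open>g n\<close>.\<close>

lemma convolution_ends:
  fixes g :: "nat \<Rightarrow> (nat \<Rightarrow>\<^sub>0 nat) \<Rightarrow>\<^sub>0 'a::field"
  assumes "g 0 = 1" and "n \<ge> 1"
  shows "(\<Sum>k=0..n. Poly_Mapping.single 0 (q powi (int n - 2 * int k)) * (g k * g (n - k))) =
    Poly_Mapping.single 0 (qpow_sum q n) * g n +
    (\<Sum>k=1..<n. Poly_Mapping.single 0 (q powi (int n - 2 * int k)) * (g k * g (n - k)))"
proof -
  have "{0..n} = insert 0 (insert n {1..<n})"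
    using assms(2) by auto
  then show ?thesis
    using assms by (simp add: qpow_sum_def single_add algebra_simps)
qed

text \<open>The recursion for \<open>Zc\<close> solves the convolution identity of \<open>alt_eval_Zvee\<close> for its top
  term. By induction the middle terms agree with those built from \<open>g\<close>, so what remains is \<open>g n\<close>.\<close>

lemma alt_eval_Zc:
  fixes q :: "'a::field"
  assumes "q \<noteq> 0" and "\<forall>n::nat. n \<ge> 1 \<longrightarrow> q ^ n \<noteq> 1" and "g 0 = 1"
  shows "alt_eval g (Zc q n) = g n"
proof (induction n rule: less_induct)
  case (less n)
  interpret H: ring_hom_ring "Uqp q" ring_of_type_algebra "alt_eval g"
    by (rule alt_eval_ring_hom_ring)
  show ?case
  proof (cases "n = 0")
    case True
    then show ?thesis
      using assms(3) H.hom_one by (simp add: Zc.simps)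
  next
    case False
    let ?S = "\<Sum>k=1..<n. Poly_Mapping.single 0 (q powi (int n - 2 * int k)) * (g k * g (n - k))"
    have "alt_eval g (Zc q n) =
        Poly_Mapping.single 0 (inverse (qpow_sum q n)) * (alt_eval g (Zvee q n) - ?S)"
      using False less
      by (subst Zc.simps) (simp add: ring_hom_ring_minus[OF alt_eval_ring_hom_ring]
          smult_Uqp_closed Zc_closed Zvee_closed alt_eval_smult qpow_sum_def Pi_def)
    also have "alt_eval g (Zvee q n) - ?S = Poly_Mapping.single 0 (qpow_sum q n) * g n"
      using False convolution_ends[of g n q] assms(3) by (simp add: alt_eval_Zvee)
    also have "Poly_Mapping.single 0 (inverse (qpow_sum q n)) * \<dots> = g n"
      using qpow_sum_nonzero[OF assms(1,2), of n] False by (simp add: mult_single flip: mult.assoc)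
    finally show ?thesis .
  qed
qed

text \<open>The sequence \<open>g\<close> with \<open>g\<^sub>0 = 1\<close> that solves \<open>\<Sum>\<^sub>k q\<^bsup>n-2k\<^esup> g\<^sub>k g\<^sub>n\<^sub>-\<^sub>k = x\<^sub>n\<close> for all
  \<open>n \<ge> 1\<close>: a \<open>q\<close>-twisted square root of the power series \<open>1 + \<Sum>\<^sub>n x\<^sub>n t\<^sup>n\<close>.\<close>

function zvee_root :: "'a::field \<Rightarrow> nat \<Rightarrow> (nat \<Rightarrow>\<^sub>0 nat) \<Rightarrow>\<^sub>0 'a" where
  "zvee_root q n =
     (if n = 0 then 1
      else Poly_Mapping.single 0 (inverse (qpow_sum q n)) *
        (indet n - (\<Sum>k=1..<n. Poly_Mapping.single 0 (q powi (int n - 2 * int k)) *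
           (zvee_root q k * zvee_root q (n - k)))))"
  by pat_completeness auto
termination
  by (relation "measure snd") auto

declare zvee_root.simps [simp del]

lemma zvee_root_0 [simp]: "zvee_root q 0 = 1"
  by (simp add: zvee_root.simps)

lemma alt_eval_zvee_root_Zvee:
  fixes q :: "'a::field"
  assumes "q \<noteq> 0" and "\<forall>n::nat. n \<ge> 1 \<longrightarrow> q ^ n \<noteq> 1" and "n \<ge> 1"
  shows "alt_eval (zvee_root q) (Zvee q n) = indet n"
proof -
  let ?S = "\<Sum>k=1..<n. Poly_Mapping.single 0 (q powi (int n - 2 * int k)) *
    (zvee_root q k * zvee_root q (n - k))"
  have "Poly_Mapping.single 0 (qpow_sum q n) * zvee_root q n = indet n - ?S"
    using assms(3) qpow_sum_nonzero[OF assms]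
    by (subst zvee_root.simps) (simp add: mult_single flip: mult.assoc)
  then show ?thesis
    using convolution_ends[of "zvee_root q" n q] assms(3) by (simp add: alt_eval_Zvee)
qed

theorem corollary6p3:
  fixes q :: "'a::field"
  assumes "q \<noteq> 0"
    and "\<forall>n::nat. n \<ge> 1 \<longrightarrow> q ^ n \<noteq> 1"
  shows "algebraically_independent (Uqp q) {1..} (Zc q)
       \<and> algebraically_independent (Uqp q) {1..} (Zvee q)"
proof
  \<comment> \<open>The value at \<open>0\<close> is not the indeterminate but \<open>1\<close>, as \<open>alt_eval_Zc\<close> demands.\<close>
  let ?x = "\<lambda>n. if n = 0 then 1 else indet n"
  show "algebraically_independent (Uqp q) {1..} (Zc q)"
    by (rule algebraically_independent_if_hom_to_indets[where H = "alt_eval ?x"])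
      (simp_all add: ring_Uqp alt_eval_hom smult_Uqp_closed alt_eval_smult Zc_closed
        alt_eval_Zc assms)
  show "algebraically_independent (Uqp q) {1..} (Zvee q)"
    by (rule algebraically_independent_if_hom_to_indets[where H = "alt_eval (zvee_root q)"])
      (simp_all add: ring_Uqp alt_eval_hom smult_Uqp_closed alt_eval_smult Zvee_closed
        alt_eval_zvee_root_Zvee assms)
qed

end
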